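(* Let $v_1,\ldots,v_n$ be a set of vectors in $\mathbb{N}^n$ such that $|v_i|=d\geq 1$ for all $i$ and $\det(A)=\pm d$, where $A$ is the $n\times n$ matrix with column vectors $v_1,\ldots,v_n$. Let $C\subset\mathbb{R}^{n^2+n+1}$ be the rational pointed polyhedral cone of all $(\beta_1,\ldots,\beta_n,\gamma,\tau)$, with $\beta_1,\ldots,\beta_n,\gamma\in\mathbb{R}^n$ and $\tau\in\mathbb{R}$, satisfying $$A\beta_i=\gamma+\tau e_i\ (i=1,\ldots,n),\qquad \beta_i\geq 0\ (i=1,\ldots,n),\qquad \gamma\geq 0,\qquad \tau\geq 0,$$ and let $\mathcal{H}$ be the minimal integral Hilbert basis of $C$. Then there is a unique element $h$ of $\mathcal{H}$ with $\tau=1$, and this element gives (through its components $\beta_1,\ldots,\beta_n,\gamma$) the unique sequence $\beta_1,\ldots,\beta_n,\gamma$ of vectors in $\mathbb{N}^n$ that satisfies the following two conditions: (a) $A\beta_i=\gamma+e_i$ for all $i$; (b) the matrix $B$ whose columns are $\beta_1,\ldots,\beta_n$ has at least one zero entry in every row.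
   Context: $\mathbb{N}$ denotes the non-negative integers. For $a=(a_1,\ldots,a_n)\in\mathbb{R}^n$, $|a|=a_1+\cdots+a_n$; inequalities between vectors are entrywise. $e_i$ denotes the $i$th unit vector of $\mathbb{R}^n$, and vectors are regarded as column vectors when multiplied by $A$. $\det(A)=\pm d$ means $\det(A)\in\{d,-d\}$. The minimal integral Hilbert basis $\mathcal{H}$ of a rational pointed polyhedral cone $C\subset\mathbb{R}^\ell$ is the unique minimal (relative to taking subsets) finite set of integral vectors such that $C=\mathbb{R}_+\mathcal{H}$ and $\mathbb{Z}^\ell\cap\mathbb{R}_+\mathcal{H}=\mathbb{N}\mathcal{H}$, where $\mathbb{R}_+\mathcal{H}$ (resp. $\mathbb{N}\mathcal{H}$) is the set of all linear combinations of elements of $\mathcal{H}$ with non-negative real (resp. non-negative integer) coefficients.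
   Formalization: The formal theorem assumes n ≥ 2; for n = 1 the claim is false, since A = (d) and condition (b) would force β_1 = 0 and hence γ = -1, which is not in N. *)

theory Defs
  imports "HOL-Analysis.Analysis"
begin

text \<open>The lattice of integral vectors, with respect to the standard basis.\<close>

definition integral_lattice :: "'a::euclidean_space set" where
  "integral_lattice = {x. \<forall>b\<in>Basis. x \<bullet> b \<in> \<int>}"

text \<open>Both spans below are only meant for finite \<open>H\<close>.\<close>

definition nonneg_real_span :: "'a::real_vector set \<Rightarrow> 'a set" where
  "nonneg_real_span H = {(\<Sum>h\<in>H. c h *\<^sub>R h) | c :: 'a \<Rightarrow> real. \<forall>h\<in>H. 0 \<le> c h}"

definition nonneg_int_span :: "'a::real_vector set \<Rightarrow> 'a set" where
  "nonneg_int_span H = {(\<Sum>h\<in>H. real (c h) *\<^sub>R h) | c :: 'a \<Rightarrow> nat. True}"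

definition is_hilbert_basis :: "'a::euclidean_space set \<Rightarrow> 'a set \<Rightarrow> bool" where
  "is_hilbert_basis C H \<longleftrightarrow>
     finite H \<and> H \<subseteq> integral_lattice \<and> C = nonneg_real_span H \<and>
     integral_lattice \<inter> nonneg_real_span H = nonneg_int_span H"

text \<open>For a rational pointed polyhedral cone there is exactly one inclusion-minimal integral
  Hilbert basis, so the description is proper there; nothing is known about its value for
  other sets \<open>C\<close>.\<close>

definition minimal_hilbert_basis :: "'a::euclidean_space set \<Rightarrow> 'a set" where
  "minimal_hilbert_basis C =
     (THE H. is_hilbert_basis C H \<and> (\<forall>G. G \<subset> H \<longrightarrow> \<not> is_hilbert_basis C G))"

text \<open>The ambient space of dimension \<open>n\<^sup>2 + n + 1\<close> is the product type of triples
  \<open>(\<beta>, \<gamma>, \<tau>)\<close>. Here \<open>\<beta> $ i\<close> is the vector \<open>\<beta>\<^sub>i\<close>, so \<open>\<beta>\<close> is the sequence of these vectors; the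
  matrix having them as columns is \<open>transpose \<beta>\<close>.\<close>

definition solution_cone :: "real^'n^'n \<Rightarrow> ((real^'n^'n) \<times> (real^'n) \<times> real) set" where
  "solution_cone A = {(\<beta>, \<gamma>, \<tau>).
     (\<forall>i. A *v (\<beta> $ i) = \<gamma> + \<tau> *\<^sub>R axis i 1) \<and>
     (\<forall>i j. 0 \<le> \<beta> $ i $ j) \<and> (\<forall>j. 0 \<le> \<gamma> $ j) \<and> 0 \<le> \<tau>}"

definition tau :: "(real^'n^'n) \<times> (real^'n) \<times> real \<Rightarrow> real" where
  "tau h = snd (snd h)"

definition nat_vec :: "real^'n \<Rightarrow> bool" where
  "nat_vec x \<longleftrightarrow> (\<forall>j. x $ j \<in> \<nat>)"

text \<open>For \<open>n = 1\<close> no pair satisfies this: a zero in the only row of \<open>B\<close> gives \<open>\<beta>\<^sub>1 = 0\<close> and hence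
  \<open>\<gamma> = -1\<close>. Hence \<open>n \<ge> 2\<close> has to be assumed.\<close>

definition nat_solution :: "real^'n^'n \<Rightarrow> real^'n^'n \<Rightarrow> real^'n \<Rightarrow> bool" where
  "nat_solution A \<beta> \<gamma> \<longleftrightarrow>
     (\<forall>i. nat_vec (\<beta> $ i)) \<and> nat_vec \<gamma> \<and>
     (\<forall>i. A *v (\<beta> $ i) = \<gamma> + axis i 1) \<and>
     (let B = transpose \<beta> in \<forall>j. \<exists>k. B $ j $ k = 0)"

lemma integral_lattice_triple_iff:
  fixes \<beta> :: "real^'n^'n" and \<gamma> :: "real^'n" and \<tau> :: real
  shows "(\<beta>, \<gamma>, \<tau>) \<in> integral_lattice \<longleftrightarrow>
    (\<forall>i j. \<beta> $ i $ j \<in> \<int>) \<and> (\<forall>j. \<gamma> $ j \<in> \<int>) \<and> \<tau> \<in> \<int>"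
  unfolding integral_lattice_def
  by (force simp: Basis_prod_def Basis_vec_def inner_axis)

end

theory Submission
  imports Defs
begin

text \<open>Let \<open>W\<^sub>i\<close> be the columns of the inverse of \<open>A\<close>. By Cramer's rule the entries of \<open>W\<^sub>i - W\<^sub>k\<close> are
  quotients by \<open>\<plusminus>d\<close> of determinants of integral matrices all of whose column sums are divisible
  by \<open>d\<close>, so these differences are integral. With \<open>m\<^sub>j = - min\<^sub>i W\<^sub>i\<^sub>j\<close>, every point of the cone
  is uniquely \<open>\<beta>\<^sub>i = p + \<tau> (m + W\<^sub>i)\<close>, \<open>\<gamma> = A (p + \<tau> m)\<close> with \<open>p \<ge> 0\<close> and \<open>\<tau> \<ge> 0\<close>, and it is
  integral iff \<open>p\<close> and \<open>\<tau>\<close> are. So the cone is simplicial and unimodular, its minimal Hilbert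
  basis consists of the \<open>n + 1\<close> generators, and only one of them has \<open>\<tau> \<noteq> 0\<close>.\<close>

section \<open>Linearly independent Hilbert bases\<close>

lemma subset_nonneg_int_span:
  assumes "finite H"
  shows "H \<subseteq> nonneg_int_span H"
proof
  fix x assume x: "x \<in> H"
  have "(\<Sum>h\<in>H. real (if h = x then 1 else 0) *\<^sub>R h) = (\<Sum>h\<in>H. if h = x then h else 0)"
    by (rule sum.cong) auto
  also have "\<dots> = x"
    using assms x by simp
  finally show "x \<in> nonneg_int_span H"
    unfolding nonneg_int_span_def by (intro CollectI exI[of _ "\<lambda>h. if h = x then 1 else 0"]) simp
qed

text \<open>An element \<open>g\<close> of \<open>H\<close> is irreducible: expand it over
  \<open>G\<close> and each element of \<open>G\<close> over \<open>H\<close>. Comparing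
  coefficients by independence, natural numbers leave room for just one summand that contributes to
  \<open>g\<close>, and the element of \<open>G\<close> in it must be \<open>g\<close>.\<close>

lemma independent_subset_generators:
  fixes G H :: "'a::euclidean_space set"
  assumes G: "finite G" and H: "finite H" "independent H"
    and eq: "nonneg_int_span G = nonneg_int_span H"
  shows "H \<subseteq> G"
proof
  fix g assume g: "g \<in> H"
  have "\<forall>x\<in>G. \<exists>a :: 'a \<Rightarrow> nat. x = (\<Sum>h\<in>H. real (a h) *\<^sub>R h)"
    using subset_nonneg_int_span[OF G] unfolding eq by (auto simp: nonneg_int_span_def)
  then obtain a :: "'a \<Rightarrow> 'a \<Rightarrow> nat" where a: "\<And>x. x \<in> G \<Longrightarrow> x = (\<Sum>h\<in>H. real (a x h) *\<^sub>R h)"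
    by metis
  have "g \<in> nonneg_int_span G"
    using g subset_nonneg_int_span[OF H(1)] eq by auto
  then obtain c :: "'a \<Rightarrow> nat" where c: "g = (\<Sum>x\<in>G. real (c x) *\<^sub>R x)"
    by (auto simp: nonneg_int_span_def)
  \<comment> \<open>The coefficient of \<open>h\<close> after substituting one expansion into the
    other; by independence it is 1 at \<open>g\<close> and 0 elsewhere.\<close>
  define s where "s h = (\<Sum>x\<in>G. c x * a x h)" for h
  have "g = (\<Sum>x\<in>G. real (c x) *\<^sub>R (\<Sum>h\<in>H. real (a x h) *\<^sub>R h))"
    unfolding c using a by (intro sum.cong) auto
  also have "\<dots> = (\<Sum>h\<in>H. \<Sum>x\<in>G. (real (c x) * real (a x h)) *\<^sub>R h)"
    by (subst sum.swap) (simp add: scaleR_sum_right)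
  also have "\<dots> = (\<Sum>h\<in>H. real (s h) *\<^sub>R h)"
    by (simp add: s_def scaleR_sum_left)
  finally have gs: "g = (\<Sum>h\<in>H. real (s h) *\<^sub>R h)" .
  have "(\<Sum>h\<in>H. (if h = g then 1 else 0) *\<^sub>R h) = (\<Sum>h\<in>H. if h = g then h else 0)"
    by (rule sum.cong) auto
  also have "\<dots> = g"
    using H(1) g by simp
  finally have "(\<Sum>h\<in>H. (real (s h) - (if h = g then 1 else 0)) *\<^sub>R h) = 0"
    using gs by (simp add: scaleR_left_diff_distrib sum_subtractf)
  then have "real (s h) - (if h = g then 1 else 0) = 0" if "h \<in> H" for h
    using that independentD[OF H(2) H(1) order_refl, where u = "\<lambda>h. real (s h) - (if h = g then 1 else 0)"]
    by blast
  then have s: "s h = (if h = g then 1 else 0)" if "h \<in> H" for h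
    using that by force
  have sg: "s g = 1" using s[OF g] by simp
  have "s g \<noteq> 0" using sg by simp
  then obtain x where x: "x \<in> G" "c x * a x g \<noteq> 0"
    unfolding s_def by (meson sum.neutral)
  \<comment> \<open>No cancellation can occur among natural numbers, so each summand is bounded by
    the whole coefficient.\<close>
  have le: "c x * a x h \<le> s h" for h
    unfolding s_def by (rule member_le_sum) (use x G in auto)
  have "c x * a x g = 1"
    using le[of g] sg x(2) by linarith
  then have ax1: "a x g = 1" by simp
  have ax0: "a x h = 0" if "h \<in> H" "h \<noteq> g" for h
    using le[of h] s[OF that(1)] that x(2) by simp
  have "x = (\<Sum>h\<in>H. if h = g then h else 0)"
    by (subst a[OF x(1)], rule sum.cong) (use ax1 ax0 in auto)
  then have "x = g"
    using H(1) g by simp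
  with x show "g \<in> G" by simp
qed

text \<open>An independent Hilbert basis lies inside every other one, so it is the least one; this
  gives both the existence and the uniqueness that the description operator requires.\<close>

lemma minimal_hilbert_basis_eqI:
  assumes H: "is_hilbert_basis C H" and ind: "independent H"
  shows "minimal_hilbert_basis C = H"
proof -
  have sub: "H \<subseteq> G" if "is_hilbert_basis C G" for G
    by (rule independent_subset_generators) (use that H ind in \<open>auto simp: is_hilbert_basis_def\<close>)
  show ?thesis
    unfolding minimal_hilbert_basis_def
    by (rule the_equality) (use sub H in blast)+
qed

section \<open>Integral matrices with column sums divisible by \<open>d\<close>\<close>

lemma det_in_Ints:
  fixes M :: "real^'n^'n"
  assumes "\<And>i j. M $ i $ j \<in> \<int>"
  shows "det M \<in> \<int>"
  unfolding det_def by (intro Ints_sum Ints_mult Ints_prod) (use assms in auto)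

text \<open>Adding all other rows to one row keeps the determinant and turns that row into
  \<open>c\<close> times the integral row \<open>r\<close>, so \<open>c\<close> can be pulled
  out.\<close>

lemma det_column_sums_dvd:
  fixes M :: "real^'n^'n"
  assumes int: "\<And>i j. M $ i $ j \<in> \<int>"
    and r: "\<And>j. r $ j \<in> \<int>" "\<And>j. (\<Sum>i\<in>UNIV. M $ i $ j) = c * r $ j"
  obtains z where "z \<in> \<int>" "det M = c * z"
proof
  fix q :: 'n
  let ?x = "\<Sum>k\<in>UNIV - {q}. row k M"
  let ?N = "\<chi> k. if k = q then r else row k M"
  have "?x \<in> span {row j M |j. j \<noteq> q}"
    by (intro span_sum span_base) auto
  then have "det M = det (\<chi> k. if k = q then row q M + ?x else row k M)"
    by (intro det_row_span[symmetric]) (simp add: span_vec_eq)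
  also have "row q M + ?x = (\<Sum>k\<in>UNIV. row k M)"
    by (simp add: sum.remove[of UNIV q])
  also have "\<dots> = c *s r"
    by (simp add: vec_eq_iff row_def r(2))
  also have "det (\<chi> k. if k = q then c *s r else row k M) = c * det ?N"
    by (rule det_row_mul)
  finally show "det M = c * det ?N" .
  show "det ?N \<in> \<int>"
    by (rule det_in_Ints) (use int r in \<open>auto simp: row_def\<close>)
qed

text \<open>In Cramer's rule the numerator is \<open>c\<close> times an integer and the denominator
  is \<open>c\<close> up to sign.\<close>

lemma integral_solution:
  fixes A :: "real^'n^'n"
  assumes A: "\<And>i j. A $ i $ j \<in> \<int>" "\<And>j. (\<Sum>i\<in>UNIV. A $ i $ j) = c"
    and det: "det A \<in> {c, - c}" and c: "c \<noteq> 0"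
    and b: "\<And>i. b $ i \<in> \<int>" "(\<Sum>i\<in>UNIV. b $ i) = 0"
    and x: "A *v x = b"
  shows "x $ k \<in> \<int>"
proof -
  let ?M = "\<chi> i j. if j = k then b $ i else A $ i $ j"
  have "det A \<noteq> 0" using det c by auto
  from iffD1[OF cramer[OF this] x] have xk: "x $ k = det ?M / det A"
    by (metis (no_types, lifting) vec_lambda_beta)
  obtain z where z: "z \<in> \<int>" "det ?M = c * z"
  \<comment> \<open>Column \<open>k\<close> is now \<open>b\<close>, which sums to 0; every other
    column still sums to \<open>c\<close>.\<close>
  proof (rule det_column_sums_dvd[of ?M "\<chi> j. if j = k then 0 else 1" c])
    show "(\<Sum>i\<in>UNIV. ?M $ i $ j) = c * (\<chi> j. if j = k then 0 else 1) $ j" for j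
      using A(2) b(2) by (cases "j = k") auto
  qed (use A b in auto)
  have "x $ k = z \<or> x $ k = - z"
    using xk z det c by auto
  with z show ?thesis by auto
qed

section \<open>The generators of the solution cone\<close>

text \<open>\<open>W\<close> is the transposed inverse of \<open>A\<close>: its rows are indexed
  like the vectors \<open>\<beta> $ i\<close>.\<close>

locale column_matrix =
  fixes A W :: "real^'n::finite^'n" and d :: nat
  assumes card: "CARD('n) \<ge> 2"
    and A_nat: "\<And>i j. A $ i $ j \<in> \<nat>"
    and column_sum: "\<And>j. (\<Sum>i\<in>UNIV. A $ i $ j) = real d"
    and d_pos: "d \<ge> 1"
    and det_A: "det A \<in> {real d, - real d}"
    and A_W: "\<And>i. A *v (W $ i) = axis i 1"
begin

text \<open>The entrywise least shift that makes all \<open>m + W $ i\<close> nonnegative.\<close>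

definition m :: "real^'n" where
  "m = (\<chi> j. - Min (range (\<lambda>i. W $ i $ j)))"

definition top_gen :: "(real^'n^'n) \<times> (real^'n) \<times> real" where
  "top_gen = (\<chi> i. m + W $ i, A *v m, 1)"

text \<open>At \<tau> = 0 injectivity of \<open>A\<close> forces all \<open>\<beta> $ i\<close> to
  coincide, so this face is a copy of the nonnegative orthant, generated by unit vectors.\<close>

definition flat_gen :: "'n \<Rightarrow> (real^'n^'n) \<times> (real^'n) \<times> real" where
  "flat_gen j = (\<chi> i. axis j 1, A *v axis j 1, 0)"

definition generators :: "((real^'n^'n) \<times> (real^'n) \<times> real) set" where
  "generators = insert top_gen (range flat_gen)"

lemma A_inj: "A *v x = A *v y \<Longrightarrow> x = y"
proof -
  have "invertible A"
    using det_A d_pos by (auto simp: invertible_det_nz)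
  then show "A *v x = A *v y \<Longrightarrow> x = y"
    by (metis inj_matrix_vector_mult injD)
qed

lemma A_nonneg: "0 \<le> A $ i $ j" and A_Ints: "A $ i $ j \<in> \<int>"
  using A_nat[of i j] Nats_subset_Ints by (auto simp: Nats_altdef2)

lemma mult_Ints: "(A *v x) $ i \<in> \<int>" if "\<And>j. x $ j \<in> \<int>"
  unfolding matrix_vector_mult_def using that A_Ints by (auto intro!: Ints_sum Ints_mult)

lemma mult_nonneg: "0 \<le> (A *v x) $ i" if "\<And>j. 0 \<le> x $ j"
  unfolding matrix_vector_mult_def using that A_nonneg by (auto intro!: sum_nonneg)

section \<open>Sign and integrality of the top generator\<close>

lemma m_W_nonneg: "0 \<le> m $ j + W $ i $ j"
  using Min_le[of "range (\<lambda>i. W $ i $ j)" "W $ i $ j"] by (simp add: m_def del: minus_Min_eq_Max)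

lemma m_W_zero: "\<exists>i. m $ j + W $ i $ j = 0"
proof -
  have "Min (range (\<lambda>i. W $ i $ j)) \<in> range (\<lambda>i. W $ i $ j)"
    by (rule Min_in) auto
  then obtain i where "Min (range (\<lambda>i. W $ i $ j)) = W $ i $ j" by blast
  then have "m $ j + W $ i $ j = 0" by (simp only: m_def vec_lambda_beta left_minus)
  then show ?thesis ..
qed

text \<open>The entries of \<open>W $ i\<close> sum to 1/d, so a single \<open>W $ i\<close> is not
  integral for d > 1. A difference solves a system whose right-hand side sums to 0.\<close>

lemma W_diff_Ints: "W $ i $ j - W $ k $ j \<in> \<int>"
proof -
  have "(W $ i - W $ k) $ j \<in> \<int>"
  proof (rule integral_solution[OF A_Ints column_sum det_A])
    show "A *v (W $ i - W $ k) = axis i 1 - axis k 1"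
      by (simp add: matrix_vector_mult_diff_distrib A_W)
    show "(axis i 1 - axis k 1 :: real^'n) $ l \<in> \<int>" for l
      by (simp add: axis_def)
    show "(\<Sum>l\<in>UNIV. (axis i 1 - axis k 1 :: real^'n) $ l) = 0"
      by (simp add: axis_def sum_subtractf)
  qed (use d_pos in auto)
  then show ?thesis by simp
qed

text \<open>The minimum is attained, so \<open>- m $ j\<close> is itself some
  \<open>W $ k $ j\<close>.\<close>

lemma m_W_Ints: "m $ j + W $ i $ j \<in> \<int>"
proof -
  obtain k where "m $ j + W $ k $ j = 0" using m_W_zero by blast
  then have "m $ j + W $ i $ j = W $ i $ j - W $ k $ j" by simp
  then show ?thesis using W_diff_Ints by simp
qed

text \<open>The vectors \<open>A *v m\<close> and \<open>A *v (m + W $ i)\<close> differ by the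
  \<open>i\<close>th unit vector only, and two indices suffice to choose \<open>i\<close> different
  from \<open>j\<close>. Sign and integrality thus pass from \<open>m + W $ i\<close> to
  \<open>A *v m\<close>.\<close>

lemma A_m_component:
  obtains i where "(A *v m) $ j = (A *v (m + W $ i)) $ j"
proof -
  obtain i where i: "i \<noteq> j"
    using card ex_card[of 2 "UNIV :: 'n set"]
    by (metis (full_types) card_2_iff')
  show thesis
    by (rule that[of i]) (use i in \<open>simp add: matrix_vector_right_distrib A_W axis_def\<close>)
qed

lemma A_m_nonneg: "0 \<le> (A *v m) $ j"
  by (rule A_m_component[of j]) (simp add: mult_nonneg m_W_nonneg)

lemma A_m_Ints: "(A *v m) $ j \<in> \<int>"
  by (rule A_m_component[of j]) (simp add: mult_Ints m_W_Ints)

section \<open>Combinations of the generators and coordinates of solutions\<close>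

lemma inj_flat_gen: "inj flat_gen"
  by (rule injI) (auto simp: flat_gen_def vec_eq_iff axis_def split: if_splits)

lemma flat_combination:
  "(\<Sum>j\<in>UNIV. a j *\<^sub>R flat_gen j) = (\<chi> i. \<chi> j. a j, A *v (\<chi> j. a j), 0)"
proof -
  have p: "(\<chi> j. a j) = (\<Sum>j\<in>UNIV. a j *\<^sub>R axis j 1)"
    by (simp add: vec_eq_iff axis_def if_distrib cong: if_cong)
  have "A *v (\<chi> j. a j) = (\<Sum>j\<in>UNIV. a j *\<^sub>R (A *v axis j 1))"
    unfolding p by (simp add: linear_sum linear_scale)
  moreover have "(\<Sum>j\<in>UNIV. a j *\<^sub>R (\<chi> i. axis j 1)) = (\<chi> i. \<chi> j. a j)"
    unfolding p by (simp add: vec_eq_iff)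
  ultimately show ?thesis
    by (simp add: prod_eq_iff fst_sum snd_sum flat_gen_def)
qed

text \<open>The normal form from which independence and both spans are read off: \<open>p\<close>
  collects the coefficients of the flat generators, and \<tau> is the coefficient of
  \<open>top_gen\<close>.\<close>

lemma generator_combination:
  "(\<Sum>h\<in>generators. c h *\<^sub>R h) =
    (\<chi> i. (\<chi> j. c (flat_gen j)) + c top_gen *\<^sub>R (m + W $ i),
     A *v ((\<chi> j. c (flat_gen j)) + c top_gen *\<^sub>R m), c top_gen)"
proof -
  have "top_gen \<notin> range flat_gen"
    by (auto simp: top_gen_def flat_gen_def)
  then have "(\<Sum>h\<in>generators. c h *\<^sub>R h) =
      c top_gen *\<^sub>R top_gen + (\<Sum>j\<in>UNIV. c (flat_gen j) *\<^sub>R flat_gen j)"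
    unfolding generators_def by (simp add: sum.reindex[OF inj_flat_gen])
  also have "(\<Sum>j\<in>UNIV. c (flat_gen j) *\<^sub>R flat_gen j) =
      (\<chi> i. \<chi> j. c (flat_gen j), A *v (\<chi> j. c (flat_gen j)), 0)"
    by (rule flat_combination)
  finally show ?thesis
    by (simp add: top_gen_def vec_eq_iff algebra_simps)
qed

lemma finite_generators: "finite generators"
  by (simp add: generators_def)

lemma independent_generators: "independent generators"
proof (rule independent_if_scalars_zero[OF finite_generators])
  fix c h assume "(\<Sum>h\<in>generators. c h *\<^sub>R h) = 0" and h: "h \<in> generators"
  then have "c top_gen = 0 \<and> (\<forall>j. c (flat_gen j) = 0)"
    unfolding generator_combination by (auto simp: vec_eq_iff zero_prod_def)
  with h show "c h = 0" by (auto simp: generators_def)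
qed

text \<open>Coefficients may be prescribed freely because the generators are pairwise distinct:
  \<open>flat_gen\<close> is injective and \<open>top_gen\<close> has another last
  component.\<close>

lemma generator_coefficients:
  obtains c where "c top_gen = t" "\<And>j. c (flat_gen j) = p $ j"
proof -
  let ?c = "\<lambda>h. if h = top_gen then t else p $ inv flat_gen h"
  have "?c (flat_gen j) = p $ j" for j
    using inv_f_f[OF inj_flat_gen, of j] by (simp add: top_gen_def flat_gen_def)
  then show thesis
    using that[of ?c] by simp
qed

text \<open>\<open>A\<close> maps every \<open>\<beta> $ i - t *\<^sub>R W $ i\<close> to
  \<open>\<gamma>\<close>, so by injectivity this vector does not depend on \<open>i\<close>;
  subtracting \<open>t *\<^sub>R m\<close> gives \<open>p\<close>.\<close>

lemma solution_coordinates: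
  assumes "\<And>i. A *v (\<beta> $ i) = \<gamma> + t *\<^sub>R axis i 1"
  obtains p where "\<And>i. \<beta> $ i = p + t *\<^sub>R (m + W $ i)" "\<gamma> = A *v (p + t *\<^sub>R m)"
proof -
  fix k :: 'n
  let ?u = "\<beta> $ k - t *\<^sub>R W $ k"
  have u: "A *v ?u = \<gamma>"
    using assms by (simp add: matrix_vector_mult_diff_distrib matrix_vector_mult_scaleR A_W)
  have "\<beta> $ i = ?u + t *\<^sub>R W $ i" for i
    by (rule A_inj) (use u assms in
        \<open>simp add: matrix_vector_right_distrib matrix_vector_mult_scaleR A_W\<close>)
  then show thesis
    using that[of "?u - t *\<^sub>R m"] u by (simp add: algebra_simps)
qed

text \<open>Wherever \<open>m + W $ i\<close> vanishes in coordinate \<open>j\<close>, the entry of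
  \<open>\<beta> $ i\<close> is \<open>p $ j\<close> itself.\<close>

lemma offset_nonneg:
  assumes "\<And>i j. 0 \<le> \<beta> $ i $ j" "\<And>i. \<beta> $ i = p + t *\<^sub>R (m + W $ i)"
  shows "0 \<le> p $ j"
proof -
  obtain i where "m $ j + W $ i $ j = 0" using m_W_zero by blast
  then have "p $ j = \<beta> $ i $ j" using assms(2)[of i] by simp
  then show ?thesis using assms(1) by simp
qed

section \<open>The Hilbert basis of the cone\<close>

lemma cone_eq_span: "solution_cone A = nonneg_real_span generators"
proof (intro set_eqI iffI)
  fix x assume "x \<in> solution_cone A"
  then obtain \<beta> \<gamma> t where x: "x = (\<beta>, \<gamma>, t)"
    and eq: "\<And>i. A *v (\<beta> $ i) = \<gamma> + t *\<^sub>R axis i 1"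
    and nn: "\<And>i j. 0 \<le> \<beta> $ i $ j" "0 \<le> t"
    by (auto simp: solution_cone_def)
  obtain p where p: "\<And>i. \<beta> $ i = p + t *\<^sub>R (m + W $ i)" "\<gamma> = A *v (p + t *\<^sub>R m)"
    using solution_coordinates[OF eq] by blast
  obtain c where c: "c top_gen = t" "\<And>j. c (flat_gen j) = p $ j"
    by (rule generator_coefficients[of t p]) (rule that)
  have "(\<chi> j. c (flat_gen j)) = p" "\<beta> = (\<chi> i. p + t *\<^sub>R (m + W $ i))"
    using c(2) p(1) by (simp_all add: vec_eq_iff)
  then have "x = (\<Sum>h\<in>generators. c h *\<^sub>R h)"
    unfolding generator_combination x c(1) p(2) by simp
  moreover have "\<forall>h\<in>generators. 0 \<le> c h"
    using c nn(2) offset_nonneg[OF nn(1) p(1)] by (auto simp: generators_def)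
  ultimately show "x \<in> nonneg_real_span generators"
    by (auto simp: nonneg_real_span_def)
next
  fix x assume "x \<in> nonneg_real_span generators"
  then obtain c where x: "x = (\<Sum>h\<in>generators. c h *\<^sub>R h)" and c: "\<forall>h\<in>generators. 0 \<le> c h"
    by (auto simp: nonneg_real_span_def)
  then have nn: "0 \<le> c top_gen" "\<And>j. 0 \<le> c (flat_gen j)"
    by (auto simp: generators_def)
  let ?p = "\<chi> j. c (flat_gen j)" and ?t = "c top_gen"
  have "A *v (?p + ?t *\<^sub>R (m + W $ i)) = A *v (?p + ?t *\<^sub>R m) + ?t *\<^sub>R axis i 1" for i
    by (simp only: matrix_vector_right_distrib matrix_vector_mult_scaleR A_W scaleR_right_distrib
        add.assoc)
  moreover have "0 \<le> (?p + ?t *\<^sub>R (m + W $ i)) $ j" for i j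
    using nn m_W_nonneg[of j i] by simp
  moreover have "0 \<le> (A *v (?p + ?t *\<^sub>R m)) $ j" for j
    using nn mult_nonneg[of ?p j] A_m_nonneg[of j]
    by (simp add: matrix_vector_right_distrib matrix_vector_mult_scaleR)
  ultimately show "x \<in> solution_cone A"
    unfolding x generator_combination solution_cone_def using nn(1) by simp
qed

lemma lattice_span: "integral_lattice \<inter> nonneg_real_span generators = nonneg_int_span generators"
proof (intro set_eqI iffI)
  fix x assume x: "x \<in> integral_lattice \<inter> nonneg_real_span generators"
  then obtain c where xc: "x = (\<Sum>h\<in>generators. c h *\<^sub>R h)" and c: "\<forall>h\<in>generators. 0 \<le> c h"
    by (auto simp: nonneg_real_span_def)
  have int: "c (flat_gen j) + c top_gen * (m $ j + W $ i $ j) \<in> \<int>" "c top_gen \<in> \<int>" for i j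
    using x unfolding xc generator_combination
    by (auto simp: integral_lattice_triple_iff)
  \<comment> \<open>Choose \<open>i\<close> with \<open>m $ j + W $ i $ j = 0\<close>; the integral
    entry at \<open>i\<close>, \<open>j\<close> then equals this coefficient.\<close>
  have "c (flat_gen j) \<in> \<int>" for j
    using m_W_zero[of j] int(1)[of j] by (metis add.right_neutral mult_zero_right)
  then have "c h \<in> \<int>" if "h \<in> generators" for h
    using that int(2) by (auto simp: generators_def)
  then have "c h = real (nat \<lfloor>c h\<rfloor>)" if "h \<in> generators" for h
    using that c by (auto elim!: Ints_cases)
  then have "x = (\<Sum>h\<in>generators. real (nat \<lfloor>c h\<rfloor>) *\<^sub>R h)"
    unfolding xc by (intro sum.cong) auto
  then show "x \<in> nonneg_int_span generators"
    unfolding nonneg_int_span_def by (auto intro!: exI[of _ "\<lambda>h. nat \<lfloor>c h\<rfloor>"])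
next
  fix x assume "x \<in> nonneg_int_span generators"
  then obtain c :: "_ \<Rightarrow> nat" where x: "x = (\<Sum>h\<in>generators. real (c h) *\<^sub>R h)"
    by (auto simp: nonneg_int_span_def)
  have "x \<in> integral_lattice"
    unfolding x generator_combination integral_lattice_triple_iff
    using m_W_Ints A_m_Ints
    by (auto simp: matrix_vector_right_distrib matrix_vector_mult_scaleR
        intro!: Ints_add Ints_mult mult_Ints)
  moreover have "x \<in> nonneg_real_span generators"
    unfolding nonneg_real_span_def x by (auto intro!: exI[of _ "\<lambda>h. real (c h)"])
  ultimately show "x \<in> integral_lattice \<inter> nonneg_real_span generators" by blast
qed

lemma minimal_hilbert_basis_cone: "minimal_hilbert_basis (solution_cone A) = generators"
proof (rule minimal_hilbert_basis_eqI[OF _ independent_generators])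
  have "generators \<subseteq> integral_lattice"
    using subset_nonneg_int_span[OF finite_generators] lattice_span by blast
  then show "is_hilbert_basis (solution_cone A) generators"
    using finite_generators lattice_span cone_eq_span by (auto simp: is_hilbert_basis_def)
qed

text \<open>Row \<open>j\<close> of B holds the \<open>j\<close>th entries of all
  \<open>\<beta> $ k\<close>. A zero there forces \<open>p $ j\<close> to be at most 0, as
  \<open>m + W $ k\<close> is nonnegative, hence \<open>p = 0\<close>. Conversely, the attained
  minimum in \<open>m\<close> puts a zero into each row.\<close>

lemma nat_solution_iff: "nat_solution A \<beta> \<gamma> \<longleftrightarrow> (\<beta>, \<gamma>, 1) = top_gen"
proof
  assume sol: "nat_solution A \<beta> \<gamma>"
  then have "\<And>i. A *v (\<beta> $ i) = \<gamma> + 1 *\<^sub>R axis i 1"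
    by (simp add: nat_solution_def)
  then obtain p where "\<And>i. \<beta> $ i = p + 1 *\<^sub>R (m + W $ i)" "\<gamma> = A *v (p + 1 *\<^sub>R m)"
    using solution_coordinates[of \<beta> \<gamma> 1] by blast
  then have p: "\<And>i. \<beta> $ i = p + 1 *\<^sub>R (m + W $ i)" "\<gamma> = A *v (p + m)" by auto
  have nn: "\<And>i j. 0 \<le> \<beta> $ i $ j"
    using sol by (auto simp: nat_solution_def nat_vec_def Nats_altdef2)
  have "p $ j = 0" for j
  proof -
    obtain k where "\<beta> $ k $ j = 0"
      using sol unfolding nat_solution_def transpose_def by (metis vec_lambda_beta)
    then have "p $ j \<le> 0" using p(1)[of k] m_W_nonneg[of j k] by simp
    with offset_nonneg[OF nn p(1)] show ?thesis by (simp add: order_antisym)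
  qed
  then have "p = 0" by (simp add: vec_eq_iff)
  with p show "(\<beta>, \<gamma>, 1) = top_gen"
    by (simp add: top_gen_def vec_eq_iff)
next
  assume "(\<beta>, \<gamma>, 1) = top_gen"
  then have "\<beta> = (\<chi> i. m + W $ i)" "\<gamma> = A *v m" by (auto simp: top_gen_def)
  then show "nat_solution A \<beta> \<gamma>"
    using m_W_Ints m_W_nonneg A_m_Ints A_m_nonneg m_W_zero
    by (auto simp: nat_solution_def nat_vec_def Nats_altdef2 transpose_def
        matrix_vector_right_distrib A_W)
qed

end

theorem theorem3p2:
  fixes v :: "'n::finite \<Rightarrow> real^'n" and d :: nat and A :: "real^'n^'n"
    and H :: "((real^'n^'n) \<times> (real^'n) \<times> real) set"
  assumes "CARD('n) \<ge> 2"
    and "\<And>i. nat_vec (v i)"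
    and "\<And>i. (\<Sum>j\<in>UNIV. v i $ j) = real d"
    and "d \<ge> 1"
    and "A = (\<chi> j i. v i $ j)"
    and "det A \<in> {real d, - real d}"
    and "H = minimal_hilbert_basis (solution_cone A)"
  shows "(\<exists>!h. h \<in> H \<and> tau h = 1) \<and>
    (\<forall>\<beta> \<gamma>. (\<beta>, \<gamma>, 1) \<in> H \<longrightarrow>
       nat_solution A \<beta> \<gamma> \<and>
       (\<forall>\<beta>' \<gamma>'. nat_solution A \<beta>' \<gamma>' \<longrightarrow> \<beta>' = \<beta> \<and> \<gamma>' = \<gamma>))"
proof -
  have "invertible A"
    using assms(4,6) by (auto simp: invertible_det_nz)
  then obtain A' where A': "A ** A' = mat 1"
    by (auto simp: invertible_def)
  define W :: "real^'n^'n" where "W = (\<chi> i. A' *v axis i 1)"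
  have "A *v (W $ i) = axis i 1" for i
    by (simp add: W_def matrix_vector_mul_assoc A')
  then interpret column_matrix A W d
    using assms by unfold_locales (auto simp: nat_vec_def)
  have H: "H = insert top_gen (range flat_gen)"
    using assms(7) minimal_hilbert_basis_cone by (simp add: generators_def)
  have tau: "tau top_gen = 1" "\<And>j. tau (flat_gen j) = 0"
    by (simp_all add: tau_def top_gen_def flat_gen_def)
  \<comment> \<open>All flat generators have \<tau> = 0, which leaves \<open>top_gen\<close>
    alone.\<close>
  have tau_iff: "h \<in> H \<and> tau h = 1 \<longleftrightarrow> h = top_gen" for h
    using tau by (auto simp: H)
  have "nat_solution A \<beta> \<gamma> \<and> (\<forall>\<beta>' \<gamma>'. nat_solution A \<beta>' \<gamma>' \<longrightarrow> \<beta>' = \<beta> \<and> \<gamma>' = \<gamma>)"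
    if "(\<beta>, \<gamma>, 1) \<in> H" for \<beta> \<gamma>
  proof -
    have "(\<beta>, \<gamma>, 1) = top_gen"
      using that tau_iff[of "(\<beta>, \<gamma>, 1)"] by (simp add: tau_def)
    then show ?thesis
      unfolding nat_solution_iff by (metis prod.inject)
  qed
  with tau_iff show ?thesis by simp
qed

end
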